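(* Let $\alpha>0$, $s\in\mathbb{N}$, and let $w_\alpha(x)=(1-x^2)^\alpha$, $x\in(-1,1)$, be the ultraspherical weight. Then $\operatorname{ind}w_\alpha\ge s$ if and only if $\alpha>s-1$.
   Context: Let $\{p_n\}_{n\in\mathbb{Z}_+}$, $\mathbb{Z}_+=\{0,1,2,\dots\}$, be the orthonormal polynomials with respect to $w_\alpha$ on $(-1,1)$ (positive leading coefficients; these are normalized Jacobi polynomials $P_n^{(\alpha,\alpha)}$), let $\varphi_n=\sqrt{w_\alpha}\,p_n$, and let $\mathcal{D}$ be the infinite matrix $\mathcal{D}_{m,n}=\int_{-1}^1\varphi_m'(x)\varphi_n(x)\,dx$, $m,n\in\mathbb{Z}_+$. The power $\mathcal{D}^k$ is bounded if all its entries are finite, i.e. for all $m,n\in\mathbb{Z}_+$ the sum $\sum_{k_1,\dots,k_{k-1}=0}^\infty \mathcal{D}_{m,k_1}\mathcal{D}_{k_1,k_2}\cdots\mathcal{D}_{k_{k-1},n}$, taken over all $(k_1,\dots,k_{k-1})\in\mathbb{Z}_+^{k-1}$ with no prescribed order of summation, converges (for $k=1$ this just means that the entry $\mathcal{D}_{m,n}$ is finite). $\operatorname{ind}w_\alpha\ge s$ means that $\mathcal{D}^k$ is bounded for $k=1,\dots,s$. *)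

theory Defs
  imports "HOL-Analysis.Analysis" "HOL-Computational_Algebra.Polynomial"
begin

text \<open>
  Weights are functions on the reals of which only the values on \<open>(-1,1)\<close> are used.
\<close>

definition ultraspherical_weight :: "real \<Rightarrow> real \<Rightarrow> real" where
  "ultraspherical_weight \<alpha> x = (1 - x\<^sup>2) powr \<alpha>"

text \<open>
  For a given weight, at most one sequence \<open>p\<close> satisfies the following predicate.
\<close>

definition orthonormal_polys :: "(real \<Rightarrow> real) \<Rightarrow> (nat \<Rightarrow> real poly) \<Rightarrow> bool" where
  "orthonormal_polys w p \<longleftrightarrow>
     (\<forall>n. degree (p n) = n \<and> lead_coeff (p n) > 0) \<and>
     (\<forall>m n. (LBINT x:{-1<..<1}. poly (p m) x * poly (p n) x * w x) = (if m = n then 1 else 0))"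

definition wfun :: "(real \<Rightarrow> real) \<Rightarrow> (nat \<Rightarrow> real poly) \<Rightarrow> nat \<Rightarrow> real \<Rightarrow> real" where
  "wfun w p n x = sqrt (w x) * poly (p n) x"

definition diff_matrix :: "(real \<Rightarrow> real) \<Rightarrow> (nat \<Rightarrow> real poly) \<Rightarrow> nat \<Rightarrow> nat \<Rightarrow> real" where
  "diff_matrix w p m n = (LBINT x:{-1<..<1}. deriv (wfun w p m) x * wfun w p n x)"

definition diff_matrix_finite :: "(real \<Rightarrow> real) \<Rightarrow> (nat \<Rightarrow> real poly) \<Rightarrow> bool" where
  "diff_matrix_finite w p \<longleftrightarrow>
     (\<forall>m n. set_integrable lborel {-1<..<1} (\<lambda>x. deriv (wfun w p m) x * wfun w p n x))"

text \<open>
  For \<open>js = [k\<^sub>1, \<dots>, k\<^sub>r]\<close>, the product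
  \<open>A m k\<^sub>1 * A k\<^sub>1 k\<^sub>2 * \<dots> * A k\<^sub>r n\<close>; for \<open>js = []\<close> it is \<open>A m n\<close>.
\<close>

fun path_prod :: "(nat \<Rightarrow> nat \<Rightarrow> real) \<Rightarrow> nat \<Rightarrow> nat list \<Rightarrow> nat \<Rightarrow> real" where
  "path_prod A m [] n = A m n"
| "path_prod A m (j # js) n = A m j * path_prod A j js n"

text \<open>
  The index tuples \<open>(k\<^sub>1, \<dots>, k\<^bsub>k-1\<^esub>)\<close> are the lists of length \<open>k - 1\<close>, and
  convergence of the sum over them is unordered (\<open>summable_on\<close>). For \<open>k = 1\<close> the sum
  has the single term \<open>A m n\<close>, so the condition reduces to the finiteness of the entries
  of the matrix itself. This finiteness has to be stated separately because the
  Lebesgue integral of a non-integrable function is 0 by convention. The definition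
  is meant for \<open>k \<ge> 1\<close> only.
\<close>

definition diff_power_bounded :: "(real \<Rightarrow> real) \<Rightarrow> (nat \<Rightarrow> real poly) \<Rightarrow> nat \<Rightarrow> bool" where
  "diff_power_bounded w p k \<longleftrightarrow>
     diff_matrix_finite w p \<and>
     (\<forall>m n. (\<lambda>js. path_prod (diff_matrix w p) m js n) summable_on {js. length js = k - 1})"

definition ind_ge :: "(real \<Rightarrow> real) \<Rightarrow> (nat \<Rightarrow> real poly) \<Rightarrow> nat \<Rightarrow> bool" where
  "ind_ge w p s \<longleftrightarrow> (\<forall>k\<in>{1..s}. diff_power_bounded w p k)"

end

theory Submission
  imports Defs
begin

text \<open>
  Everything rests on a two-sided estimate of the entries of the differentiation matrix \<open>D\<close>:
  for \<open>m + n\<close> odd,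
  \<open>\<bar>D m n\<bar> \<approx> sqrt ((m+1) (n+1)) * (min / max) powr \<alpha>\<close>, where \<open>min\<close> and \<open>max\<close>
  are those of \<open>m + 1\<close> and \<open>n + 1\<close>; for \<open>m + n\<close> even the entry is \<open>0\<close>.

  Most of the estimate is algebra. Let \<open>I q\<close> be the integral of the polynomial \<open>q\<close> against
  \<open>(1 - x\<^sup>2) powr \<alpha>\<close>. Integrating by parts removes the singular factor
  \<open>(1 - x\<^sup>2) powr (\<alpha> - 1)\<close> and leaves \<open>2 * D m n = I (p\<^sub>m' * p\<^sub>n) - I (p\<^sub>m * p\<^sub>n')\<close>.
  For \<open>m < n\<close> the first term vanishes by degree, and the second is evaluated with the
  identity \<open>I (((1 - x\<^sup>2) q)') = 2 \<alpha> I (x q)\<close>, applied to a combination of \<open>p\<^sub>m\<close> and \<open>x p\<^sub>n\<close> that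
  vanishes at \<open>1\<close> and \<open>-1\<close> and is therefore a multiple of \<open>1 - x\<^sup>2\<close>. The result is, for
  \<open>m + n\<close> odd, the rank-one formula
  \<open>I (p\<^sub>m * p\<^sub>n') = (2 n + 2 \<alpha> + 1) p\<^sub>m(1) / p\<^sub>n(1)\<close>
  (\<open>inner_pderiv_opposite_parity\<close>). Together with the three-term recurrence
  at \<open>x = 1\<close> it also determines \<open>p\<^sub>n(1)\<^sup>2\<close>, a multiple of
  \<open>(2 n + 2 \<alpha> + 1) * pochhammer (2 \<alpha> + 1) n / n!\<close>, so that \<open>p\<^sub>n(1) \<approx> (n+1) powr (\<alpha> + 1/2)\<close>
  (\<open>poly_1_growth\<close>); this gives the estimate (\<open>skew_entries_bounds\<close>).

  Now let \<open>r = k - 1\<close> be the number of summation indices of an entry of \<open>D ^ k\<close>. For every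
  \<open>\<gamma>\<close> between \<open>-\<alpha>\<close> and \<open>\<alpha>\<close>, the factor \<open>(min / max) powr \<alpha>\<close> is at most
  \<open>((m+1) / (n+1)) powr \<gamma>\<close>. Letting \<open>\<gamma>\<close> decrease by
  \<open>2 + \<epsilon>\<close> from one factor of the product to the next bounds a path by a product of
  \<open>(k\<^sub>i + 1) powr (-1 - \<epsilon>)\<close>; there is room for this if \<open>2 \<alpha> > 2 r\<close>
  (\<open>summable_path_prod\<close>).
  Conversely, among the paths with all \<open>k\<^sub>i\<close> of size \<open>K\<close> there are \<open>K ^ r\<close> with alternating
  parities, each with a product of order \<open>K powr (r - 2 \<alpha>)\<close>. If \<open>\<alpha> \<le> r\<close> each of these blocks
  contributes at least a fixed positive amount, and the sum diverges (\<open>not_summable_path_prod\<close>).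
\<close>

section \<open>Orthonormal ultraspherical polynomials at the endpoint\<close>

text \<open>
  The properties of integration against \<open>(1 - x\<^sup>2) powr \<alpha>\<close> from which all entries of the
  matrix can be computed. The equation \<open>pearson\<close> is what identifies the parameter \<open>\<alpha>\<close>: it
  says that the integral of the derivative of \<open>(1 - x\<^sup>2) powr (\<alpha> + 1) * q\<close> is \<open>0\<close>.
\<close>

locale gegenbauer_functional =
  fixes I :: "real poly \<Rightarrow> real" and \<alpha> :: real and p :: "nat \<Rightarrow> real poly"
  assumes add: "I (q + r) = I q + I r"
    and smult: "I (smult c q) = c * I q"
    and reflect: "I (q \<circ>\<^sub>p [:0, -1:]) = I q"
    and pearson: "I ([:1, 0, -1:] * pderiv q) = 2 * (\<alpha> + 1) * I ([:0, 1:] * q)"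
    and alpha_pos: "\<alpha> > 0"
    and degree_p [simp]: "degree (p n) = n"
    and lead_pos: "coeff (p n) n > 0"
    and orthonormal: "I (p m * p n) = (if m = n then 1 else 0)"
begin

lemma zero [simp]: "I 0 = 0"
  using smult[of 0 0] by simp

lemma minus: "I (- q) = - I q"
  using smult[of "-1" q] by simp

lemma diff: "I (q - r) = I q - I r"
  using add[of q "- r"] minus[of r] by simp

lemma orthogonal_lower_degree:
  assumes "degree q < n"
  shows "I (q * p n) = 0"
  using assms
proof (induction "degree q" arbitrary: q rule: less_induct)
  case less
  define d where "d = degree q"
  define r where "r = q - Polynomial.smult (coeff q d / coeff (p d) d) (p d)"
  have "coeff (p d) d \<noteq> 0" using lead_pos[of d] by simp
  then have "coeff r d = 0" by (simp add: r_def)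
  moreover have "degree r \<le> d"
    unfolding r_def by (intro degree_diff_le) (auto simp: d_def intro: order.trans[OF degree_smult_le])
  ultimately have r: "r = 0 \<or> degree r < d"
    by (metis le_neq_implies_less leading_coeff_0_iff)
  have "I (r * p n) = 0"
    using r less by (auto simp: d_def)
  moreover have "q * p n = r * p n + Polynomial.smult (coeff q d / coeff (p d) d) (p d * p n)"
    by (simp add: r_def algebra_simps)
  moreover have "I (p d * p n) = 0"
    using less.prems by (simp add: orthonormal d_def)
  ultimately show ?case by (simp add: add smult)
qed

text \<open>
  By this, a pairing with \<open>p n\<close> can be read off from leading coefficients.
\<close>

lemma inner_eq_coeff:
  assumes "degree q \<le> n"
  shows "I (q * p n) = coeff q n / coeff (p n) n"
proof -
  define c where "c = coeff q n / coeff (p n) n"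
  define r where "r = q - Polynomial.smult c (p n)"
  have "coeff (p n) n \<noteq> 0" using lead_pos[of n] by simp
  then have "coeff r n = 0" by (simp add: r_def c_def)
  moreover have "degree r \<le> n"
    unfolding r_def using assms
    by (intro degree_diff_le) (auto intro: order.trans[OF degree_smult_le])
  ultimately have r: "r = 0 \<or> degree r < n"
    by (metis le_neq_implies_less leading_coeff_0_iff)
  have "q * p n = r * p n + Polynomial.smult c (p n * p n)"
    by (simp add: r_def algebra_simps)
  moreover have "I (r * p n) = 0"
    using r by (auto simp: orthogonal_lower_degree)
  ultimately show ?thesis by (simp add: add smult orthonormal c_def)
qed

lemma eq_0_if_orthogonal:
  assumes "degree q \<le> n" and "\<And>j. j \<le> n \<Longrightarrow> I (q * p j) = 0"
  shows "q = 0"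
  using assms inner_eq_coeff[of q "degree q"] lead_pos[of "degree q"] by auto

text \<open>
  The reflected \<open>p n\<close> is again orthogonal to all polynomials of lower degree, hence a
  multiple of \<open>p n\<close>; the leading coefficient gives the sign.
\<close>

lemma reflect_p: "p n \<circ>\<^sub>p [:0, -1:] = Polynomial.smult ((-1) ^ n) (p n)"
proof -
  let ?R = "\<lambda>q::real poly. q \<circ>\<^sub>p [:0, -1:]"
  have deg [simp]: "degree (?R q) = degree q" for q by (simp add: degree_pcompose)
  have coeff: "coeff (?R (p n)) n = (-1) ^ n * coeff (p n) n"
    using lead_coeff_comp[of "[:0, -1:]" "p n"] by simp
  define g where "g = ?R (p n) - Polynomial.smult ((-1) ^ n) (p n)"
  have "g = 0"
  proof (rule eq_0_if_orthogonal)
    show dg: "degree g \<le> n"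
      unfolding g_def by (intro degree_diff_le) (auto intro: order.trans[OF degree_smult_le])
    fix j assume "j \<le> n"
    show "I (g * p j) = 0"
    proof (cases "j = n")
      case True
      then show ?thesis using inner_eq_coeff[OF dg] coeff by (simp add: g_def)
    next
      case False
      have "?R (?R (p n) * p j) = p n * ?R (p j)"
        by (simp add: pcompose_mult pcompose_assoc[symmetric] pcompose_pCons)
      then have "I (?R (p n) * p j) = I (?R (p j) * p n)"
        by (metis reflect mult.commute)
      also have "\<dots> = 0"
        using False \<open>j \<le> n\<close> by (intro orthogonal_lower_degree) auto
      finally show ?thesis
        using False by (simp add: g_def left_diff_distrib diff smult orthonormal)
    qed
  qed
  then show ?thesis by (simp add: g_def)
qed

lemma poly_minus_1: "poly (p n) (-1) = (-1) ^ n * poly (p n) 1"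
  using arg_cong[OF reflect_p[of n], of "\<lambda>q. poly q 1"] by (simp add: poly_pcompose)

lemma odd_eq_0:
  assumes "q \<circ>\<^sub>p [:0, -1:] = - q"
  shows "I q = 0"
  using reflect[of q] assms by (simp add: minus)

lemma inner_pderiv_same_parity:
  assumes "even (m + n)"
  shows "I (p m * pderiv (p n)) = 0"
proof (rule odd_eq_0)
  have "pderiv (p n) \<circ>\<^sub>p [:0, -1:] = - pderiv (p n \<circ>\<^sub>p [:0, -1:])"
    by (simp add: pderiv_pcompose pderiv_pCons)
  also have "\<dots> = - Polynomial.smult ((-1) ^ n) (pderiv (p n))"
    by (simp add: reflect_p pderiv_smult)
  finally show "(p m * pderiv (p n)) \<circ>\<^sub>p [:0, -1:] = - (p m * pderiv (p n))"
    using assms by (simp add: pcompose_mult reflect_p flip: power_add)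
qed

lemma inner_pderiv_lower:
  assumes "m \<le> n"
  shows "I (pderiv (p m) * p n) = 0"
proof (cases "m = 0")
  case True
  then have "pderiv (p m) = 0" by (simp add: pderiv_eq_0_iff)
  then show ?thesis by simp
next
  case False
  then show ?thesis using assms by (intro orthogonal_lower_degree) (simp add: degree_pderiv)
qed

text \<open>
  Integration by parts: moving the derivative to the weight leaves the factor
  \<open>2 \<alpha> x / (1 - x\<^sup>2)\<close>, whose denominator cancels.
\<close>

lemma pderiv_of_vanishing_at_ends:
  "I (pderiv ([:1, 0, -1:] * q)) = 2 * \<alpha> * I ([:0, 1:] * q)"
proof -
  have *: "pderiv [:1, 0, -1 :: real:] = Polynomial.smult (-2) [:0, 1:]"
    by (simp add: pderiv_pCons)
  have "I (pderiv ([:1, 0, -1:] * q)) = 2 * (\<alpha> + 1) * I ([:0, 1:] * q) - 2 * I ([:0, 1:] * q)"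
    unfolding pderiv_mult add pearson * by (simp only: mult_smult_right smult mult.commute[of q])
  then show ?thesis by (simp add: algebra_simps)
qed

text \<open>
  The dependence on \<open>m\<close> is only through \<open>p\<^sub>m(1)\<close>. The reason is that
  \<open>q = p\<^sub>m(1) x p\<^sub>n - p\<^sub>n(1) p\<^sub>m\<close> vanishes at \<open>1\<close> and, by parity, at \<open>-1\<close>. So \<open>q = (1 - x\<^sup>2) h\<close>,
  and in \<open>I (q p\<^sub>n') = I ((q p\<^sub>n)') - I (q' p\<^sub>n)\<close> both terms on the right
  pair \<open>p\<^sub>n\<close> with a polynomial of degree at most \<open>n\<close>, the first one by the preceding lemma.
  So they are read off from leading coefficients, as is the contribution of \<open>x p\<^sub>n\<close> on the left.
\<close>

lemma inner_pderiv_opposite_parity: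
  assumes "m < n" and "odd (m + n)"
  shows "poly (p n) 1 * I (p m * pderiv (p n)) = (2 * real n + 2 * \<alpha> + 1) * poly (p m) 1"
proof -
  define a where "a = poly (p m) 1"
  define b where "b = poly (p n) 1"
  define k where "k = coeff (p n) n"
  have k: "k \<noteq> 0" using lead_pos[of n] by (simp add: k_def)
  \<comment> \<open>The coefficients are chosen such that \<open>q\<close> vanishes at both endpoints.\<close>
  define q where "q = Polynomial.smult a ([:0, 1:] * p n) - Polynomial.smult b (p m)"
  have "poly q 1 = 0" by (simp add: q_def a_def b_def)
  moreover have "poly q (-1) = 0"
    using assms(2) by (auto simp: q_def poly_minus_1 a_def b_def uminus_power_if)
  ultimately obtain h where h: "q = [:1, 0, -1:] * h"
  proof -
    obtain g where g: "q = [:-1, 1:] * g"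
      using \<open>poly q 1 = 0\<close> by (auto simp: poly_eq_0_iff_dvd elim: dvdE)
    with \<open>poly q (-1) = 0\<close> have "poly g (-1) = 0" by simp
    then obtain h where "g = [:1, 1:] * h"
      by (auto simp: poly_eq_0_iff_dvd elim: dvdE)
    with g have "q = [:1, 0, -1:] * (- h)" by simp
    then show ?thesis using that by blast
  qed
  have dq: "degree q \<le> n + 1"
    unfolding q_def using assms(1)
    by (intro degree_diff_le) (auto intro!: order.trans[OF degree_smult_le] order.trans[OF degree_pCons_le])
  have cq: "coeff q (Suc n) = a * k"
    using assms(1) by (simp add: q_def k_def coeff_eq_0)
  have dh: "degree h \<le> n - 1"
  proof (cases "h = 0")
    case False
    then have "degree q = 2 + degree h"
      unfolding h by (subst degree_mult_eq) auto
    then show ?thesis using dq by simp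
  qed simp
  have "coeff q (Suc n) = - coeff h (n - 1)"
    using assms(1) dh by (cases n) (auto simp: h coeff_eq_0)
  then have ch: "coeff h (n - 1) = - a * k" using cq by simp
  have "I (pderiv (q * p n)) = 2 * \<alpha> * I ([:0, 1:] * h * p n)"
    using pderiv_of_vanishing_at_ends[of "h * p n"] by (simp only: h mult.assoc)
  also have "I ([:0, 1:] * h * p n) = coeff ([:0, 1:] * h) n / k"
    unfolding k_def using dh assms(1)
    by (intro inner_eq_coeff) (auto intro!: order.trans[OF degree_pCons_le])
  also have "\<dots> = - a"
    using assms(1) ch k by (cases n) auto
  finally have 1: "I (pderiv (q * p n)) = - 2 * \<alpha> * a" by simp
  have 2: "I (pderiv q * p n) = (n + 1) * a"
    using dq cq k by (subst inner_eq_coeff) (auto simp: degree_pderiv coeff_pderiv k_def)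
  have 3: "I ([:0, 1:] * pderiv (p n) * p n) = n"
    using k assms(1)
    by (subst inner_eq_coeff; cases n)
       (auto simp: degree_pderiv coeff_pderiv k_def intro!: order.trans[OF degree_pCons_le])
  have "I (q * pderiv (p n)) = a * I ([:0, 1:] * pderiv (p n) * p n) - b * I (p m * pderiv (p n))"
    unfolding q_def left_diff_distrib diff mult_smult_left smult by (simp only: mult_ac)
  moreover have "I (q * pderiv (p n)) = I (pderiv (q * p n)) - I (pderiv q * p n)"
    by (simp add: pderiv_mult add algebra_simps)
  ultimately show ?thesis
    using 1 2 3 by (simp add: a_def b_def algebra_simps)
qed

lemma inner_pderiv_Suc:
  "I (p n * pderiv (p (Suc n))) = real (Suc n) * coeff (p (Suc n)) (Suc n) / coeff (p n) n"
  by (subst mult.commute, subst inner_eq_coeff) (auto simp: degree_pderiv coeff_pderiv)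

text \<open>
  The pairing of \<open>p\<^sub>n\<close> with the derivative of its successor is known in two ways: from the
  leading coefficients, and from the rank-one formula. Comparing them
  gives one relation between consecutive endpoint values; the recurrence gives a second one,
  and the product of the two is free of leading coefficients.
\<close>

lemma poly_1_step_derivative:
  "real (Suc n) * coeff (p (Suc n)) (Suc n) * poly (p (Suc n)) 1
     = (2 * real n + 2 * \<alpha> + 3) * coeff (p n) n * poly (p n) 1"
  using inner_pderiv_opposite_parity[of n "Suc n"] lead_pos[of n]
  by (simp add: inner_pderiv_Suc field_simps)

lemma inner_x:
  "I ([:0, 1:] * p n * p (Suc n)) = coeff (p n) n / coeff (p (Suc n)) (Suc n)"
  by (subst inner_eq_coeff) (auto intro!: order.trans[OF degree_pCons_le])

lemma three_term_recurrence:
  defines "\<beta> \<equiv> \<lambda>n. coeff (p n) n / coeff (p (Suc n)) (Suc n)"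
  shows "[:0, 1:] * p (Suc n) = Polynomial.smult (\<beta> (Suc n)) (p (Suc (Suc n))) + Polynomial.smult (\<beta> n) (p n)"
    and "[:0, 1:] * p 0 = Polynomial.smult (\<beta> 0) (p (Suc 0))"
proof -
  have odd: "I ([:0, 1:] * p n * p n) = 0" for n
    by (rule odd_eq_0) (simp add: pcompose_mult pcompose_pCons reflect_p flip: power_add)
  have far: "I ([:0, 1:] * p n * p j) = 0" if "Suc j < n" for n j
  proof -
    have "degree ([:0, 1:] * p j) < n"
      using that by (auto intro!: le_less_trans[OF degree_pCons_le])
    from orthogonal_lower_degree[OF this] show ?thesis by (simp add: algebra_simps)
  qed
  have inner_x': "I ([:0, 1:] * p (Suc n) * p n) = \<beta> n" for n
    using inner_x[of n] by (simp add: \<beta>_def algebra_simps)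
  note inner_x = inner_x[folded \<beta>_def]
  show "[:0, 1:] * p (Suc n) = Polynomial.smult (\<beta> (Suc n)) (p (Suc (Suc n))) + Polynomial.smult (\<beta> n) (p n)"
  proof -
    let ?g = "[:0, 1:] * p (Suc n) - (Polynomial.smult (\<beta> (Suc n)) (p (Suc (Suc n))) + Polynomial.smult (\<beta> n) (p n))"
    have "?g = 0"
    proof (rule eq_0_if_orthogonal)
      show "degree ?g \<le> Suc (Suc n)"
        by (intro degree_diff_le degree_add_le)
           (auto intro!: order.trans[OF degree_smult_le] order.trans[OF degree_pCons_le])
      fix j assume "j \<le> Suc (Suc n)"
      then consider "Suc j < Suc n" | "j = n" | "j = Suc n" | "j = Suc (Suc n)" by linarith
      then show "I (?g * p j) = 0"
        unfolding left_diff_distrib distrib_right diff add mult_smult_left smult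
        by cases (use inner_x[of "Suc n"] inner_x'[of n] odd[of "Suc n"] far in
                   \<open>simp_all add: orthonormal \<beta>_def del: mult_pCons_left\<close>)
    qed
    then show ?thesis by (simp only: right_minus_eq)
  qed
  show "[:0, 1:] * p 0 = Polynomial.smult (\<beta> 0) (p (Suc 0))"
  proof -
    let ?g = "[:0, 1:] * p 0 - Polynomial.smult (\<beta> 0) (p (Suc 0))"
    have "?g = 0"
    proof (rule eq_0_if_orthogonal)
      show "degree ?g \<le> Suc 0"
        by (intro degree_diff_le)
           (auto intro!: order.trans[OF degree_smult_le] order.trans[OF degree_pCons_le])
      fix j :: nat assume "j \<le> Suc 0"
      then consider "j = 0" | "j = Suc 0" by linarith
      then show "I (?g * p j) = 0"
        unfolding left_diff_distrib distrib_right diff add mult_smult_left smult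
        by cases (use inner_x[of 0] odd[of 0] in
                   \<open>simp_all add: orthonormal \<beta>_def del: mult_pCons_left\<close>)
    qed
    then show ?thesis by (simp only: right_minus_eq)
  qed
qed

text \<open>
  In the three-term recurrence at \<open>x = 1\<close>, the previous relation turns the term with
  \<open>p\<^sub>n\<^sub>-\<^sub>1(1)\<close> into the fraction \<open>n / (2 n + 2 \<alpha> + 1)\<close> of \<open>p\<^sub>n(1)\<close>.
\<close>

lemma poly_1_step_recurrence:
  "(2 * real n + 2 * \<alpha> + 1) * coeff (p n) n * poly (p (Suc n)) 1
     = (real n + 2 * \<alpha> + 1) * coeff (p (Suc n)) (Suc n) * poly (p n) 1"
proof (cases n)
  case 0
  have "poly (p 0) 1 = coeff (p 0) 0 / coeff (p (Suc 0)) (Suc 0) * poly (p (Suc 0)) 1"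
    using arg_cong[OF three_term_recurrence(2), of "\<lambda>q. poly q 1"] by simp
  then show ?thesis using 0 lead_pos[of 1] by (simp add: field_simps)
next
  case (Suc j)
  have *: "poly (p n) 1 = coeff (p n) n / coeff (p (Suc n)) (Suc n) * poly (p (Suc n)) 1
      + coeff (p j) j / coeff (p n) n * poly (p j) 1"
    using arg_cong[OF three_term_recurrence(1)[of j], of "\<lambda>q. poly q 1"] Suc by simp
  have "coeff (p j) j / coeff (p n) n * poly (p j) 1
      = real n / (2 * real n + 2 * \<alpha> + 1) * poly (p n) 1"
    using poly_1_step_derivative[of j] lead_pos[of n] alpha_pos Suc
    by (simp add: field_simps)
  with * have "coeff (p n) n / coeff (p (Suc n)) (Suc n) * poly (p (Suc n)) 1
      = poly (p n) 1 - real n / (2 * real n + 2 * \<alpha> + 1) * poly (p n) 1"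
    by linarith
  also have "\<dots> = (1 - real n / (2 * real n + 2 * \<alpha> + 1)) * poly (p n) 1"
    by (simp only: left_diff_distrib mult_1_left)
  also have "1 - real n / (2 * real n + 2 * \<alpha> + 1) = (real n + 2 * \<alpha> + 1) / (2 * real n + 2 * \<alpha> + 1)"
    using alpha_pos by (simp add: field_simps)
  finally show ?thesis
    using lead_pos[of "Suc n"] alpha_pos by (simp add: field_simps)
qed

lemma poly_1_pos: "poly (p n) 1 > 0"
proof (induction n)
  case 0
  have "p 0 = [:coeff (p 0) 0:]" using degree_p[of 0] by (simp add: degree_0_id)
  then have "poly (p 0) 1 = coeff (p 0) 0" by (metis poly_pCons poly_0 mult_zero_right add.right_neutral)
  then show ?case using lead_pos[of 0] by simp
next
  case (Suc n)
  have "(2 * real n + 2 * \<alpha> + 1) * coeff (p n) n * poly (p (Suc n)) 1 > 0"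
    unfolding poly_1_step_recurrence using Suc lead_pos[of "Suc n"] alpha_pos by (intro mult_pos_pos) auto
  moreover have "(2 * real n + 2 * \<alpha> + 1) * coeff (p n) n > 0"
    using lead_pos[of n] alpha_pos by simp
  ultimately show ?case by (simp add: zero_less_mult_iff)
qed

lemma poly_1_square_rec:
  "(poly (p (Suc n)) 1)\<^sup>2 * (real (Suc n) * (2 * real n + 2 * \<alpha> + 1))
     = (poly (p n) 1)\<^sup>2 * ((real n + 2 * \<alpha> + 1) * (2 * real n + 2 * \<alpha> + 3))"
proof -
  define k where "k = coeff (p n) n"
  define k' where "k' = coeff (p (Suc n)) (Suc n)"
  define P where "P = poly (p n) 1"
  define P' where "P' = poly (p (Suc n)) 1"
  have "(k * k') * (P'\<^sup>2 * (real (Suc n) * (2 * real n + 2 * \<alpha> + 1)))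
      = (real (Suc n) * k' * P') * ((2 * real n + 2 * \<alpha> + 1) * k * P')"
    by (simp add: power2_eq_square)
  also have "\<dots> = ((2 * real n + 2 * \<alpha> + 3) * k * P) * ((real n + 2 * \<alpha> + 1) * k' * P)"
    unfolding k_def k'_def P_def P'_def poly_1_step_derivative poly_1_step_recurrence ..
  also have "\<dots> = (k * k') * (P\<^sup>2 * ((real n + 2 * \<alpha> + 1) * (2 * real n + 2 * \<alpha> + 3)))"
    by (simp add: power2_eq_square)
  finally show ?thesis
    using lead_pos[of n] lead_pos[of "Suc n"] by (simp add: k_def k'_def P_def P'_def)
qed

text \<open>
  The classical value at \<open>1\<close> of the normalised ultraspherical polynomials, relative to that
  of \<open>p\<^sub>0\<close>. The quotient \<open>(2 n + 2 \<alpha> + 3) / (2 n + 2 \<alpha> + 1)\<close> in the recursion telescopes.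
\<close>

lemma poly_1_square:
  "(poly (p n) 1)\<^sup>2 * ((2 * \<alpha> + 1) * fact n)
     = (poly (p 0) 1)\<^sup>2 * ((2 * real n + 2 * \<alpha> + 1) * pochhammer (2 * \<alpha> + 1) n)"
proof (induction n)
  case (Suc n)
  define c where "c = 2 * real n + 2 * \<alpha> + 1"
  have c: "c \<noteq> 0" using alpha_pos by (simp add: c_def)
  have "c * ((poly (p (Suc n)) 1)\<^sup>2 * ((2 * \<alpha> + 1) * fact (Suc n)))
      = ((poly (p (Suc n)) 1)\<^sup>2 * (real (Suc n) * c)) * ((2 * \<alpha> + 1) * fact n)"
    by simp
  also have "\<dots> = ((poly (p n) 1)\<^sup>2 * ((2 * \<alpha> + 1) * fact n)) * ((real n + 2 * \<alpha> + 1) * (2 * real n + 2 * \<alpha> + 3))"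
    unfolding c_def poly_1_square_rec by (simp only: mult_ac)
  also have "\<dots> = c * ((poly (p 0) 1)\<^sup>2 * ((2 * real (Suc n) + 2 * \<alpha> + 1) * pochhammer (2 * \<alpha> + 1) (Suc n)))"
    unfolding Suc.IH c_def pochhammer_rec' by (simp add: algebra_simps)
  finally show ?case using c by simp
qed simp

end

section \<open>Growth of the endpoint values\<close>

text \<open>
  Turns an asymptotic equivalence into two-sided bounds valid for every index.
\<close>

lemma positive_limit_bounds:
  fixes f :: "nat \<Rightarrow> real"
  assumes "f \<longlonglongrightarrow> L" and "L > 0" and pos: "\<And>n. f n > 0"
  obtains a b where "a > 0" and "\<And>n. a \<le> f n" and "\<And>n. f n \<le> b"
proof -
  have "Bseq f" using assms(1) by (intro convergent_imp_Bseq convergentI)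
  then obtain b where b: "\<And>n. norm (f n) \<le> b" using BseqE by blast
  have "(\<lambda>n. inverse (f n)) \<longlonglongrightarrow> inverse L"
    using assms by (intro tendsto_inverse) auto
  then have "Bseq (\<lambda>n. inverse (f n))" by (intro convergent_imp_Bseq convergentI)
  then obtain a where a: "a > 0" "\<And>n. norm (inverse (f n)) \<le> a" using BseqE by blast
  show ?thesis
  proof (rule that)
    show "inverse a > 0" using a by simp
    show "f n \<le> b" for n using b[of n] by simp
    show "inverse a \<le> f n" for n
      using a(2)[of n] pos[of n] a(1) by (simp add: field_simps)
  qed
qed

text \<open>
  Gauss's limit for the Gamma function; \<open>real n + 1\<close> instead of \<open>real n\<close> makes the
  bounds valid for \<open>n = 0\<close> as well.
\<close>

lemma pochhammer_growth:
  fixes z :: real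
  assumes "z > 0"
  obtains a b where "a > 0"
    and "\<And>n. a * (real n + 1) powr z \<le> pochhammer (z + 1) n / fact n"
    and "\<And>n. pochhammer (z + 1) n / fact n \<le> b * (real n + 1) powr z"
proof -
  define f where "f = (\<lambda>n. pochhammer (z + 1) n / (fact n * (real n + 1) powr z))"
  have Gamma_pos: "Gamma z > 0" using assms by (rule Gamma_real_pos)
  have pos: "f n > 0" for n using assms by (simp add: f_def pochhammer_pos)
  have "(\<lambda>n. (real n / (real n + 1)) powr z / (z * Gamma_series z n)) \<longlonglongrightarrow> 1 powr z / (z * Gamma z)"
  proof (intro tendsto_intros Gamma_series_LIMSEQ)
    have "(\<lambda>n. real n / real (Suc n)) \<longlonglongrightarrow> 1" by (rule LIMSEQ_n_over_Suc_n)
    then show "(\<lambda>n. real n / (real n + 1)) \<longlonglongrightarrow> 1" by (simp add: add_ac)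
    show "z * Gamma z \<noteq> 0" using assms less_imp_neq[OF Gamma_pos] by simp
  qed simp
  moreover have "eventually (\<lambda>n. (real n / (real n + 1)) powr z / (z * Gamma_series z n) = f n) sequentially"
    using eventually_gt_at_top[of 0]
  proof eventually_elim
    case (elim n)
    have "pochhammer z (n + 1) = z * pochhammer (z + 1) n" by (simp add: pochhammer_rec)
    moreover have "exp (z * of_real (ln (real n))) = real n powr z"
      using elim by (simp add: powr_def)
    ultimately show ?case
      using elim assms by (simp add: f_def Gamma_series_def powr_divide field_simps)
  qed
  ultimately have "f \<longlonglongrightarrow> 1 powr z / (z * Gamma z)"
    by (rule Lim_transform_eventually)
  moreover have "1 powr z / (z * Gamma z) > 0" using assms Gamma_pos by simp
  ultimately obtain a b where "a > 0" "\<And>n. a \<le> f n" "\<And>n. f n \<le> b"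
    using pos positive_limit_bounds by blast
  then show ?thesis
    using that[of a b] by (simp add: f_def field_simps)
qed

context gegenbauer_functional
begin

lemma poly_1_growth:
  obtains a b where "a > 0"
    and "\<And>n. a * (real n + 1) powr (\<alpha> + 1/2) \<le> poly (p n) 1"
    and "\<And>n. poly (p n) 1 \<le> b * (real n + 1) powr (\<alpha> + 1/2)"
proof -
  obtain a b where a: "a > 0"
    and lower: "\<And>n. a * (real n + 1) powr (2 * \<alpha>) \<le> pochhammer (2 * \<alpha> + 1) n / fact n"
    and upper: "\<And>n. pochhammer (2 * \<alpha> + 1) n / fact n \<le> b * (real n + 1) powr (2 * \<alpha>)"
    using pochhammer_growth[of "2 * \<alpha>"] alpha_pos by auto
  have b: "b > 0"
    using order.trans[OF lower[of 0] upper[of 0]] a by simp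
  define c where "c = (poly (p 0) 1)\<^sup>2 / (2 * \<alpha> + 1)"
  have c: "c > 0" using alpha_pos poly_1_pos[of 0] by (simp add: c_def)
  have sq: "(poly (p n) 1)\<^sup>2 = c * ((2 * real n + 2 * \<alpha> + 1) * (pochhammer (2 * \<alpha> + 1) n / fact n))" for n
  proof -
    have "(poly (p n) 1)\<^sup>2 = (poly (p 0) 1)\<^sup>2 * ((2 * real n + 2 * \<alpha> + 1) * pochhammer (2 * \<alpha> + 1) n)
        / ((2 * \<alpha> + 1) * fact n)"
      using poly_1_square[of n] alpha_pos by (intro eq_divide_imp) auto
    then show ?thesis by (simp add: c_def)
  qed
  have powr: "sqrt (C * ((real n + 1) * (real n + 1) powr (2 * \<alpha>))) = sqrt C * (real n + 1) powr (\<alpha> + 1/2)" for C n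
  proof -
    have "(real n + 1) * (real n + 1) powr (2 * \<alpha>) = ((real n + 1) powr (\<alpha> + 1/2))\<^sup>2"
    proof -
      have "((real n + 1) powr (\<alpha> + 1/2))\<^sup>2 = (real n + 1) powr (2 * \<alpha> + 1)"
        by (simp add: power2_eq_square flip: powr_add)
      then show ?thesis by (simp add: powr_add)
    qed
    then show ?thesis by (simp add: real_sqrt_mult)
  qed
  show ?thesis
  proof (rule that)
    show "sqrt (c * a) > 0" using a c by simp
    fix n
    have "(c * a) * ((real n + 1) * (real n + 1) powr (2 * \<alpha>))
        = c * ((real n + 1) * (a * (real n + 1) powr (2 * \<alpha>)))" by simp
    also have "\<dots> \<le> (poly (p n) 1)\<^sup>2"
      unfolding sq using c a alpha_pos by (intro mult_left_mono mult_mono lower) auto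
    finally have "sqrt ((c * a) * ((real n + 1) * (real n + 1) powr (2 * \<alpha>))) \<le> poly (p n) 1"
      using poly_1_pos[of n] by (intro real_le_lsqrt) auto
    then show "sqrt (c * a) * (real n + 1) powr (\<alpha> + 1/2) \<le> poly (p n) 1"
      unfolding powr .
    have "(poly (p n) 1)\<^sup>2 \<le> c * (((2 * \<alpha> + 2) * (real n + 1)) * (b * (real n + 1) powr (2 * \<alpha>)))"
      unfolding sq using c b alpha_pos
      by (intro mult_left_mono mult_mono upper) (auto simp: algebra_simps pochhammer_nonneg)
    also have "\<dots> = (c * (2 * \<alpha> + 2) * b) * ((real n + 1) * (real n + 1) powr (2 * \<alpha>))" by simp
    finally have "poly (p n) 1 \<le> sqrt ((c * (2 * \<alpha> + 2) * b) * ((real n + 1) * (real n + 1) powr (2 * \<alpha>)))"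
      by (intro real_le_rsqrt)
    then show "poly (p n) 1 \<le> sqrt (c * (2 * \<alpha> + 2) * b) * (real n + 1) powr (\<alpha> + 1/2)"
      unfolding powr .
  qed
qed

end

section \<open>Size of the matrix entries\<close>

text \<open>
  The order of magnitude of the entries with \<open>m + n\<close> odd. It is \<open>sqrt ((m+1) (n+1))\<close> near the
  diagonal and decays away from it exponentially in the distance of \<open>ln (m+1)\<close> and \<open>ln (n+1)\<close>,
  at rate \<open>\<alpha>\<close>.
\<close>

definition envelope :: "real \<Rightarrow> nat \<Rightarrow> nat \<Rightarrow> real" where
  "envelope \<alpha> m n =
     sqrt ((real m + 1) * (real n + 1)) * ((real (min m n) + 1) / (real (max m n) + 1)) powr \<alpha>"

lemma envelope_commute: "envelope \<alpha> m n = envelope \<alpha> n m"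
  by (simp add: envelope_def min.commute max.commute mult.commute)

lemma envelope_nonneg: "envelope \<alpha> m n \<ge> 0"
  by (simp add: envelope_def)

text \<open>
  A product bound that can be tuned: different \<open>\<gamma>\<close> distribute the decay differently over
  the two indices.
\<close>

lemma envelope_le_powr:
  assumes "\<bar>\<gamma>\<bar> \<le> \<alpha>"
  shows "envelope \<alpha> m n \<le> (real m + 1) powr (1/2 + \<gamma>) * (real n + 1) powr (1/2 - \<gamma>)"
proof -
  have le: "envelope \<alpha> m n \<le> (real m + 1) powr (1/2 + \<gamma>) * (real n + 1) powr (1/2 - \<gamma>)"
    if "m \<le> n" "\<bar>\<gamma>\<bar> \<le> \<alpha>" for m n \<gamma>
  proof -
    have "((real m + 1) / (real n + 1)) powr \<alpha> \<le> ((real m + 1) / (real n + 1)) powr \<gamma>"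
      using that by (intro powr_mono') auto
    then have "envelope \<alpha> m n \<le> sqrt ((real m + 1) * (real n + 1)) * ((real m + 1) / (real n + 1)) powr \<gamma>"
      using that by (simp add: envelope_def mult_left_mono)
    also have "\<dots> = (real m + 1) powr (1/2 + \<gamma>) * (real n + 1) powr (1/2 - \<gamma>)"
      by (simp add: real_sqrt_mult powr_add powr_diff powr_divide powr_half_sqrt)
    finally show ?thesis .
  qed
  show ?thesis
  proof (cases "m \<le> n")
    case True
    then show ?thesis using le assms by blast
  next
    case False
    then show ?thesis
      using le[of n m "- \<gamma>"] assms by (simp add: envelope_commute[of \<alpha> m] mult.commute)
  qed
qed

context gegenbauer_functional
begin

text \<open>
  \<open>A\<close> is the differentiation matrix in its form without derivatives of the weight. It is
  skew-symmetric, so it suffices to treat \<open>m < n\<close>, where one of its terms vanishes and the other is known.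
\<close>

lemma skew_entries_bounds:
  defines "A \<equiv> \<lambda>m n. (I (pderiv (p m) * p n) - I (p m * pderiv (p n))) / 2"
  obtains c C where "c > 0" and "C \<ge> 0"
    and "\<And>m n. \<bar>A m n\<bar> \<le> C * envelope \<alpha> m n"
    and "\<And>m n. odd (m + n) \<Longrightarrow> c * envelope \<alpha> m n \<le> \<bar>A m n\<bar>"
proof -
  obtain a b where a: "a > 0"
    and lower: "\<And>n. a * (real n + 1) powr (\<alpha> + 1/2) \<le> poly (p n) 1"
    and upper: "\<And>n. poly (p n) 1 \<le> b * (real n + 1) powr (\<alpha> + 1/2)"
    using poly_1_growth by blast
  have b: "b > 0"
    using order.trans[OF lower[of 0] upper[of 0]] a by simp
  have env: "envelope \<alpha> m n = (real n + 1) * ((real m + 1) powr (\<alpha> + 1/2) / (real n + 1) powr (\<alpha> + 1/2))"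
    if "m < n" for m n
  proof -
    have "envelope \<alpha> m n = (real m + 1) powr (\<alpha> + 1/2) * ((real n + 1) powr (1/2) / (real n + 1) powr \<alpha>)"
      using that by (simp add: envelope_def real_sqrt_mult powr_divide powr_add powr_half_sqrt)
    also have "(real n + 1) powr (1/2) / (real n + 1) powr \<alpha> = (real n + 1) powr (1 - (\<alpha> + 1/2))"
      by (simp flip: powr_diff)
    also have "\<dots> = (real n + 1) / (real n + 1) powr (\<alpha> + 1/2)"
      by (subst powr_diff) simp
    finally show ?thesis by simp
  qed
  have odd: "a / (2 * b) * envelope \<alpha> m n \<le> \<bar>A m n\<bar> \<and> \<bar>A m n\<bar> \<le> (\<alpha> + 1) * b / a * envelope \<alpha> m n"
    if "m < n" "odd (m + n)" for m n
  proof -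
    define x where "x = (real m + 1) powr (\<alpha> + 1/2)"
    define y where "y = (real n + 1) powr (\<alpha> + 1/2)"
    have xy: "x > 0" "y > 0" by (simp_all add: x_def y_def)
    define P where "P = poly (p m) 1"
    define Q where "Q = poly (p n) 1"
    have P: "a * x \<le> P" "P \<le> b * x" and Q: "a * y \<le> Q" "Q \<le> b * y"
      unfolding P_def Q_def x_def y_def by (rule lower upper)+
    have pos: "P > 0" "Q > 0" by (simp_all add: P_def Q_def poly_1_pos)
    have "I (pderiv (p m) * p n) = 0" using that(1) by (intro inner_pderiv_lower) simp
    moreover have "I (p m * pderiv (p n)) = (2 * real n + 2 * \<alpha> + 1) * (P / Q)"
      using inner_pderiv_opposite_parity[OF that] pos by (simp add: P_def Q_def field_simps)
    ultimately have "A m n = - ((2 * real n + 2 * \<alpha> + 1) / 2 * (P / Q))"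
      by (simp add: A_def)
    then have A: "\<bar>A m n\<bar> = (2 * real n + 2 * \<alpha> + 1) / 2 * (P / Q)"
      using pos alpha_pos by simp
    have "a / (2 * b) * envelope \<alpha> m n = (real n + 1) / 2 * ((a * x) / (b * y))"
      using that(1) by (simp add: env x_def y_def mult_ac)
    also have "\<dots> \<le> \<bar>A m n\<bar>"
      unfolding A using P Q pos a xy alpha_pos by (intro mult_mono frac_le) auto
    finally have 1: "a / (2 * b) * envelope \<alpha> m n \<le> \<bar>A m n\<bar>" .
    have "(2 * real n + 2 * \<alpha> + 1) / 2 \<le> (\<alpha> + 1) * (real n + 1)"
      using alpha_pos by (simp add: algebra_simps)
    then have "\<bar>A m n\<bar> \<le> ((\<alpha> + 1) * (real n + 1)) * ((b * x) / (a * y))"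
      unfolding A using P Q pos a b xy alpha_pos by (intro mult_mono frac_le) auto
    also have "\<dots> = (\<alpha> + 1) * b / a * envelope \<alpha> m n"
      using that(1) by (simp add: env x_def y_def mult_ac)
    finally show ?thesis using 1 by simp
  qed
  have commute: "\<bar>A m n\<bar> = \<bar>A n m\<bar>" for m n
    by (simp add: A_def mult.commute abs_minus_commute)
  have odd: "a / (2 * b) * envelope \<alpha> m n \<le> \<bar>A m n\<bar> \<and> \<bar>A m n\<bar> \<le> (\<alpha> + 1) * b / a * envelope \<alpha> m n"
    if "odd (m + n)" for m n
  proof (cases "m < n")
    case True
    then show ?thesis using odd that by blast
  next
    case False
    moreover have "m \<noteq> n" using that by auto
    ultimately show ?thesis
      using odd[of n m] that by (simp add: commute[of m n] envelope_commute[of \<alpha> m n] add.commute)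
  qed
  show ?thesis
  proof (rule that)
    show "a / (2 * b) > 0" "(\<alpha> + 1) * b / a \<ge> 0" using a b alpha_pos by simp_all
    show "a / (2 * b) * envelope \<alpha> m n \<le> \<bar>A m n\<bar>" if "odd (m + n)" for m n
      using odd[OF that] by blast
    show "\<bar>A m n\<bar> \<le> (\<alpha> + 1) * b / a * envelope \<alpha> m n" for m n
    proof (cases "odd (m + n)")
      case False
      then have "A m n = 0"
        using inner_pderiv_same_parity[of m n] inner_pderiv_same_parity[of n m]
        by (simp add: A_def mult.commute add.commute)
      then show ?thesis using a b alpha_pos by (simp add: envelope_nonneg)
    qed (use odd in blast)
  qed
qed

end

section \<open>Integration against the ultraspherical weight\<close>

text \<open>
  An affine change of variables makes the weight a multiple of the integrand of the Beta
  function.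
\<close>

lemma integrable_poly_times_weight:
  fixes q :: "real poly"
  assumes "\<beta> > -1"
  shows "set_integrable lborel {-1<..<1} (\<lambda>x. poly q x * (1 - x\<^sup>2) powr \<beta>)"
proof -
  let ?f = "\<lambda>t. indicator {0..1} t *\<^sub>R (t powr \<beta> * (1 - t) powr \<beta>) :: real"
  let ?w = "\<lambda>x. indicator {-1<..<1} x *\<^sub>R (1 - x\<^sup>2) powr \<beta> :: real"
  have "integrable lborel ?f"
    using integrable_Beta[of "\<beta> + 1" "\<beta> + 1"] assms by (simp add: set_integrable_def)
  then have int: "integrable lborel (\<lambda>x. ?f (1 / 2 + 1 / 2 * x))"
    by (rule lborel_integrable_real_affine) simp
  have w: "integrable lborel ?w"
  proof (rule Bochner_Integration.integrable_bound)
    show "integrable lborel (\<lambda>x. 4 powr \<beta> * ?f (1 / 2 + 1 / 2 * x))"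
      by (intro integrable_mult_right int)
    show "AE x in lborel. norm (?w x) \<le> norm (4 powr \<beta> * ?f (1 / 2 + 1 / 2 * x))"
    proof (rule AE_I2)
      fix x :: real
      show "norm (?w x) \<le> norm (4 powr \<beta> * ?f (1 / 2 + 1 / 2 * x))"
      proof (cases "x \<in> {-1<..<1}")
        case True
        then have "(4 * ((1 / 2 + 1 / 2 * x) * (1 - (1 / 2 + 1 / 2 * x)))) powr \<beta>
            = 4 powr \<beta> * ((1 / 2 + 1 / 2 * x) powr \<beta> * (1 - (1 / 2 + 1 / 2 * x)) powr \<beta>)"
          by (simp add: powr_mult)
        moreover have "4 * ((1 / 2 + 1 / 2 * x) * (1 - (1 / 2 + 1 / 2 * x))) = 1 - x\<^sup>2"
          by (simp add: field_simps power2_eq_square)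
        ultimately show ?thesis using True by simp
      qed simp
    qed
  qed simp
  obtain C where C: "\<And>x. x \<in> {-1..1} \<Longrightarrow> norm (poly q x) \<le> C"
  proof -
    have "bounded (poly q ` {-1..1})"
      by (intro compact_imp_bounded compact_continuous_image continuous_intros) auto
    then obtain C where "\<forall>y\<in>poly q ` {-1..1}. norm y \<le> C" by (auto simp: bounded_iff)
    then show ?thesis by (intro that[of C]) blast
  qed
  have [measurable]: "poly q \<in> borel_measurable borel"
    by (intro borel_measurable_continuous_onI continuous_intros)
  show ?thesis
    unfolding set_integrable_def
  proof (rule Bochner_Integration.integrable_bound[OF integrable_mult_right[of C]])
    show "C \<noteq> 0 \<Longrightarrow> integrable lborel ?w" by (rule w)
    show "(\<lambda>x. indicator {-1<..<1} x *\<^sub>R (poly q x * (1 - x\<^sup>2) powr \<beta>)) \<in> borel_measurable lborel"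
      by measurable
    show "AE x in lborel. norm (indicator {-1<..<1} x *\<^sub>R (poly q x * (1 - x\<^sup>2) powr \<beta>))
        \<le> norm (C * ?w x)"
    proof (rule AE_I2)
      fix x :: real
      show "norm (indicator {-1<..<1} x *\<^sub>R (poly q x * (1 - x\<^sup>2) powr \<beta>)) \<le> norm (C * ?w x)"
        using C[of x] by (auto simp: indicator_def abs_mult intro!: mult_right_mono)
    qed
  qed
qed

lemma integral_derivative_vanishing_boundary:
  fixes F :: "real \<Rightarrow> real"
  assumes "set_integrable lborel {-1<..<1} f"
    and "continuous_on {-1..1} F" and "F (-1) = 0" and "F 1 = 0"
    and "\<And>x. x \<in> {-1<..<1} \<Longrightarrow> (F has_real_derivative f x) (at x)"
  shows "(LBINT x:{-1<..<1}. f x) = 0"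
proof -
  have "(f has_integral (F 1 - F (-1))) {-1..1}"
    using assms by (intro fundamental_theorem_of_calculus_interior)
      (auto simp: has_real_derivative_iff_has_vector_derivative)
  then have "(f has_integral 0) {-1<..<1}"
    using assms by (simp add: has_integral_Icc_iff_Ioo)
  then show ?thesis
    using set_borel_integral_eq_integral(2)[OF assms(1)] by (simp add: integral_unique)
qed

definition weighted_integral :: "real \<Rightarrow> real poly \<Rightarrow> real" where
  "weighted_integral \<alpha> q = (LBINT x:{-1<..<1}. poly q x * (1 - x\<^sup>2) powr \<alpha>)"

lemma square_less_1: "x \<in> {-1<..<1} \<Longrightarrow> x\<^sup>2 < (1::real)"
  by (simp add: abs_square_less_1 abs_less_iff)

text \<open>
  The boundary terms of \<open>q * (1 - x\<^sup>2) powr \<alpha>\<close> vanish because \<open>\<alpha> > 0\<close>. For \<open>\<alpha> < 1\<close> the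
  integrand on the left can be unbounded, but it is still absolutely integrable.
\<close>

lemma weighted_integral_pderiv:
  assumes "\<alpha> > 0"
  shows "(LBINT x:{-1<..<1}. poly q x * (x * (1 - x\<^sup>2) powr (\<alpha> - 1)))
      = weighted_integral \<alpha> (pderiv q) / (2 * \<alpha>)"
proof -
  let ?v = "\<lambda>x::real. poly q x * (x * (1 - x\<^sup>2) powr (\<alpha> - 1))"
  let ?w = "\<lambda>x::real. poly (pderiv q) x * (1 - x\<^sup>2) powr \<alpha>"
  have v: "set_integrable lborel {-1<..<1} ?v"
    using integrable_poly_times_weight[of "\<alpha> - 1" "q * [:0, 1:]"] assms
    by (simp add: algebra_simps)
  have w: "set_integrable lborel {-1<..<1} ?w"
    using integrable_poly_times_weight[of \<alpha>] assms by simp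
  have v': "set_integrable lborel {-1<..<1} (\<lambda>x. 2 * \<alpha> * ?v x)"
    using v by (intro set_integrable_mult_right)
  have "(LBINT x:{-1<..<1}. ?w x - 2 * \<alpha> * ?v x) = 0"
  proof (rule integral_derivative_vanishing_boundary)
    show "set_integrable lborel {-1<..<1} (\<lambda>x. ?w x - 2 * \<alpha> * ?v x)"
      using w v' by (intro set_integral_diff)
    show "continuous_on {-1..1} (\<lambda>x. poly q x * (1 - x\<^sup>2) powr \<alpha>)"
      using assms by (intro continuous_intros continuous_on_powr') (auto simp: abs_square_le_1 abs_le_iff)
    fix x :: real assume x: "x \<in> {-1<..<1}"
    from square_less_1[OF this]
    show "((\<lambda>x. poly q x * (1 - x\<^sup>2) powr \<alpha>) has_real_derivative ?w x - 2 * \<alpha> * ?v x) (at x)"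
      by (auto intro!: derivative_eq_intros simp: algebra_simps)
  qed auto
  moreover have "(LBINT x:{-1<..<1}. ?w x - 2 * \<alpha> * ?v x)
      = weighted_integral \<alpha> (pderiv q) - 2 * \<alpha> * (LBINT x:{-1<..<1}. ?v x)"
    using set_integral_diff(2)[OF w v'] unfolding weighted_integral_def set_integral_mult_right .
  ultimately show ?thesis
    using assms by (simp add: field_simps)
qed

text \<open>
  This is the preceding lemma for the exponent \<open>\<alpha> + 1\<close>.
\<close>

lemma weighted_integral_pearson:
  assumes "\<alpha> > 0"
  shows "weighted_integral \<alpha> ([:1, 0, -1:] * pderiv q) = 2 * (\<alpha> + 1) * weighted_integral \<alpha> ([:0, 1:] * q)"
proof -
  have "poly (pderiv q) x * (1 - x\<^sup>2) powr (\<alpha> + 1)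
      = poly ([:1, 0, -1:] * pderiv q) x * (1 - x\<^sup>2) powr \<alpha>" if "x \<in> {-1<..<1}" for x :: real
    using square_less_1[OF that] by (simp add: powr_add power2_eq_square algebra_simps)
  then have "weighted_integral (\<alpha> + 1) (pderiv q) = weighted_integral \<alpha> ([:1, 0, -1:] * pderiv q)"
    unfolding weighted_integral_def by (intro set_lebesgue_integral_cong) auto
  moreover have "weighted_integral \<alpha> ([:0, 1:] * q)
      = (LBINT x:{-1<..<1}. poly q x * (x * (1 - x\<^sup>2) powr (\<alpha> + 1 - 1)))"
    unfolding weighted_integral_def by (intro set_lebesgue_integral_cong) (auto simp: algebra_simps)
  ultimately show ?thesis
    using weighted_integral_pderiv[of "\<alpha> + 1" q] assms by (simp add: field_simps)
qed

lemma weighted_integral_add: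
  assumes "\<alpha> > 0"
  shows "weighted_integral \<alpha> (q + r) = weighted_integral \<alpha> q + weighted_integral \<alpha> r"
  using integrable_poly_times_weight[of \<alpha> q] integrable_poly_times_weight[of \<alpha> r] assms
  by (simp add: weighted_integral_def distrib_right)

lemma weighted_integral_smult: "weighted_integral \<alpha> (smult c q) = c * weighted_integral \<alpha> q"
  by (simp add: weighted_integral_def mult.assoc)

lemma weighted_integral_reflect: "weighted_integral \<alpha> (q \<circ>\<^sub>p [:0, -1:]) = weighted_integral \<alpha> q"
proof -
  have "{x. - x \<in> {-1<..<1}} = {-1<..<(1::real)}" by auto
  then show ?thesis
    unfolding weighted_integral_def by (subst (2) set_integral_reflect) (simp add: poly_pcompose)
qed

text \<open>
  In \<open>\<phi>\<^sub>m' \<phi>\<^sub>n\<close>, the square root of the weight contributes half the derivative of the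
  weight, of order \<open>(1 - x\<^sup>2) powr (\<alpha> - 1)\<close>. It is integrable, and
  integrating by parts moves the derivative to the polynomials.
\<close>

lemma
  assumes "\<alpha> > 0"
  shows diff_matrix_finite_ultraspherical:
      "diff_matrix_finite (ultraspherical_weight \<alpha>) p"
    and diff_matrix_eq_weighted_integral:
      "diff_matrix (ultraspherical_weight \<alpha>) p m n
        = (weighted_integral \<alpha> (pderiv (p m) * p n) - weighted_integral \<alpha> (p m * pderiv (p n))) / 2"
proof -
  let ?\<phi> = "wfun (ultraspherical_weight \<alpha>) p"
  let ?u = "\<lambda>m n x. poly (pderiv (p m) * p n) x * (1 - x\<^sup>2) powr \<alpha>"
  let ?v = "\<lambda>m n x. poly (p m * p n) x * (x * (1 - x\<^sup>2) powr (\<alpha> - 1))"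
  have eq: "deriv (?\<phi> m) x * ?\<phi> n x = ?u m n x - \<alpha> * ?v m n x"
    if "x \<in> {-1<..<1}" for m n and x :: real
  proof -
    define u where "u = sqrt ((1 - x\<^sup>2) powr \<alpha>)"
    note x = square_less_1[OF that]
    have u: "u > 0" "u * u = (1 - x\<^sup>2) powr \<alpha>" using x by (auto simp: u_def)
    have "(?\<phi> m has_real_derivative
        - (2 * x * \<alpha> * (1 - x\<^sup>2) powr (\<alpha> - 1)) * (inverse u / 2) * poly (p m) x + u * poly (pderiv (p m)) x) (at x)"
      unfolding wfun_def ultraspherical_weight_def u_def using x
      by (auto intro!: derivative_eq_intros simp: algebra_simps)
    then have "deriv (?\<phi> m) x * ?\<phi> n x =
        (- (2 * x * \<alpha> * (1 - x\<^sup>2) powr (\<alpha> - 1)) * (inverse u / 2) * poly (p m) x + u * poly (pderiv (p m)) x)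
         * (u * poly (p n) x)"
      by (simp add: DERIV_imp_deriv wfun_def ultraspherical_weight_def u_def)
    also have "\<dots> = poly (pderiv (p m) * p n) x * (u * u) - \<alpha> * ?v m n x"
      using u(1) by (simp add: field_simps)
    finally show ?thesis using u(2) by simp
  qed
  have u: "set_integrable lborel {-1<..<1} (?u m n)" for m n
    using assms by (intro integrable_poly_times_weight) simp
  have v: "set_integrable lborel {-1<..<1} (?v m n)" for m n
    using integrable_poly_times_weight[of "\<alpha> - 1" "p m * p n * [:0, 1:]"] assms
    by (simp add: algebra_simps)
  have v': "set_integrable lborel {-1<..<1} (\<lambda>x. \<alpha> * ?v m n x)" for m n
    using v by (intro set_integrable_mult_right)
  have int: "set_integrable lborel {-1<..<1} (\<lambda>x. ?u m n x - \<alpha> * ?v m n x)" for m n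
    using u v' by (intro set_integral_diff)
  show "diff_matrix_finite (ultraspherical_weight \<alpha>) p"
    unfolding diff_matrix_finite_def
    using int by (subst set_integrable_cong[OF refl refl eq]) auto
  have "diff_matrix (ultraspherical_weight \<alpha>) p m n = (LBINT x:{-1<..<1}. ?u m n x - \<alpha> * ?v m n x)"
    unfolding diff_matrix_def by (intro set_lebesgue_integral_cong) (auto simp: eq)
  also have "\<dots> = weighted_integral \<alpha> (pderiv (p m) * p n) - \<alpha> * (weighted_integral \<alpha> (pderiv (p m * p n)) / (2 * \<alpha>))"
    unfolding weighted_integral_pderiv[OF assms, symmetric]
    using set_integral_diff(2)[OF u[of m n] v'[of m n]]
    unfolding weighted_integral_def set_integral_mult_right .
  also have "weighted_integral \<alpha> (pderiv (p m * p n))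
      = weighted_integral \<alpha> (pderiv (p m) * p n) + weighted_integral \<alpha> (p m * pderiv (p n))"
    using assms by (simp add: pderiv_mult weighted_integral_add algebra_simps)
  also have "\<alpha> * ((weighted_integral \<alpha> (pderiv (p m) * p n) + weighted_integral \<alpha> (p m * pderiv (p n))) / (2 * \<alpha>))
      = (weighted_integral \<alpha> (pderiv (p m) * p n) + weighted_integral \<alpha> (p m * pderiv (p n))) / 2"
    using assms by simp
  finally show "diff_matrix (ultraspherical_weight \<alpha>) p m n
        = (weighted_integral \<alpha> (pderiv (p m) * p n) - weighted_integral \<alpha> (p m * pderiv (p n))) / 2"
    by (simp add: field_simps)
qed

lemma gegenbauer_functional_weighted_integral:
  assumes "\<alpha> > 0" and "orthonormal_polys (ultraspherical_weight \<alpha>) p"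
  shows "gegenbauer_functional (weighted_integral \<alpha>) \<alpha> p"
proof
  have deg: "degree (p n) = n" and lead: "lead_coeff (p n) > 0" for n
    using assms(2) unfolding orthonormal_polys_def by blast+
  have orth: "(LBINT x:{-1<..<1}. poly (p m) x * poly (p n) x * ultraspherical_weight \<alpha> x) = (if m = n then 1 else 0)"
    for m n using assms(2) by (simp add: orthonormal_polys_def)
  show "degree (p n) = n" for n by (rule deg)
  show "coeff (p n) n > 0" for n using lead[of n] by (simp add: deg)
  show "weighted_integral \<alpha> (p m * p n) = (if m = n then 1 else 0)" for m n
    using orth[of m n] by (simp add: weighted_integral_def ultraspherical_weight_def)
qed (use assms(1) in \<open>simp_all only: weighted_integral_add weighted_integral_smult
       weighted_integral_reflect weighted_integral_pearson\<close>)

section \<open>Absolute convergence of the path sums\<close>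

text \<open>
  The first factor is bounded with the exponent \<open>\<gamma>\<close>, the next one with \<open>\<gamma> - (2 + \<epsilon>)\<close>, and so
  on. An inner index \<open>j\<close> then occurs with exponent \<open>1/2 - \<gamma>\<close> from the factor on its left and
  \<open>1/2 + \<gamma> - (2 + \<epsilon>)\<close> from that on its right, in total \<open>-1 - \<epsilon>\<close>.
\<close>

lemma path_prod_abs_le:
  assumes A: "\<And>m n \<gamma>. \<bar>\<gamma>\<bar> \<le> \<alpha> \<Longrightarrow> \<bar>A m n\<bar> \<le> C * ((real m + 1) powr (1/2 + \<gamma>) * (real n + 1) powr (1/2 - \<gamma>))"
    and "C \<ge> 0" and "\<epsilon> > 0"
    and "\<gamma> \<le> \<alpha>" and "- \<alpha> \<le> \<gamma> - real (length js) * (2 + \<epsilon>)"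
  shows "\<bar>path_prod A m js n\<bar> \<le> C ^ Suc (length js) * ((real m + 1) powr (1/2 + \<gamma>)
    * (\<Prod>j\<leftarrow>js. (real j + 1) powr (- 1 - \<epsilon>))
    * (real n + 1) powr (1/2 - (\<gamma> - real (length js) * (2 + \<epsilon>))))"
  using assms(4,5)
proof (induction js arbitrary: m \<gamma>)
  case Nil
  then show ?case using A[of \<gamma> m n] by simp
next
  case (Cons j js)
  let ?\<gamma>' = "\<gamma> - (2 + \<epsilon>)"
  let ?P = "\<Prod>j\<leftarrow>js. (real j + 1) powr (- 1 - \<epsilon>)"
  let ?n = "(real n + 1) powr (1/2 - (\<gamma> - real (length (j # js)) * (2 + \<epsilon>)))"
  have len: "0 \<le> real (length js) * (2 + \<epsilon>)" using \<open>\<epsilon> > 0\<close> by simp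
  have eq: "?\<gamma>' - real (length js) * (2 + \<epsilon>) = \<gamma> - real (length (j # js)) * (2 + \<epsilon>)"
    by (simp add: algebra_simps)
  have "\<bar>\<gamma>\<bar> \<le> \<alpha>" using Cons.prems len \<open>\<epsilon> > 0\<close> unfolding eq[symmetric] by linarith
  then have 1: "\<bar>A m j\<bar> \<le> C * ((real m + 1) powr (1/2 + \<gamma>) * (real j + 1) powr (1/2 - \<gamma>))"
    by (rule A)
  have 2: "\<bar>path_prod A j js n\<bar> \<le> C ^ Suc (length js) * ((real j + 1) powr (1/2 + ?\<gamma>') * ?P * ?n)"
    using Cons.IH[of ?\<gamma>' j] Cons.prems \<open>\<epsilon> > 0\<close> unfolding eq by simp
  have "\<bar>path_prod A m (j # js) n\<bar> \<le>
      (C * ((real m + 1) powr (1/2 + \<gamma>) * (real j + 1) powr (1/2 - \<gamma>)))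
      * (C ^ Suc (length js) * ((real j + 1) powr (1/2 + ?\<gamma>') * ?P * ?n))"
    unfolding path_prod.simps abs_mult using \<open>C \<ge> 0\<close> by (intro mult_mono 1 2) auto
  also have "\<dots> = C ^ Suc (length (j # js)) * ((real m + 1) powr (1/2 + \<gamma>)
      * (((real j + 1) powr (1/2 - \<gamma>) * (real j + 1) powr (1/2 + ?\<gamma>')) * ?P) * ?n)"
    by simp
  also have "(real j + 1) powr (1/2 - \<gamma>) * (real j + 1) powr (1/2 + ?\<gamma>') = (real j + 1) powr (- 1 - \<epsilon>)"
    by (simp flip: powr_add)
  finally show ?case by simp
qed

lemma lists_Suc: "{js. length js = Suc r} = (\<lambda>(j, js). j # js) ` (UNIV \<times> {js. length js = r})"
  by (auto simp: length_Suc_conv image_iff)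

lemma summable_on_prod_list:
  fixes f :: "'a \<Rightarrow> real"
  assumes f: "f summable_on UNIV" and nonneg: "\<And>j. f j \<ge> 0"
  shows "(\<lambda>js. \<Prod>j\<leftarrow>js. f j) summable_on {js. length js = r}"
proof (induction r)
  case 0
  have "{js :: 'a list. length js = 0} = {[]}" by auto
  then show ?case by simp
next
  case (Suc r)
  let ?L = "{js :: 'a list. length js = r}"
  let ?P = "\<lambda>js. \<Prod>j\<leftarrow>js. f j"
  have "(\<lambda>(j, js). f j * ?P js) summable_on (UNIV \<times> ?L)"
  proof (rule summable_on_SigmaI)
    show "((\<lambda>js. case (j, js) of (j, js) \<Rightarrow> f j * ?P js) has_sum f j * infsum ?P ?L) ?L" for j
      using Suc by (auto intro!: has_sum_cmult_right has_sum_infsum)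
    show "(\<lambda>j. f j * infsum ?P ?L) summable_on UNIV"
      using f by (rule summable_on_cmult_left)
    show "0 \<le> (case (j, js) of (j, js) \<Rightarrow> f j * ?P js)" for j js
      using nonneg by (auto intro!: mult_nonneg_nonneg prod_list_nonneg)
  qed
  then have "(?P \<circ> (\<lambda>(j, js). j # js)) summable_on (UNIV \<times> ?L)"
    by (simp add: o_def case_prod_unfold)
  then show ?case
    unfolding lists_Suc by (subst summable_on_reindex) (auto simp: inj_on_def)
qed

text \<open>
  The exponents of the \<open>r + 1\<close> factors run from \<open>\<alpha>\<close> down to \<open>\<alpha> - r (2 + \<epsilon>)\<close>, which must not
  be below \<open>-\<alpha>\<close>. For \<open>\<alpha> > r\<close> some \<open>\<epsilon> > 0\<close> achieves this.
\<close>

lemma summable_path_prod: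
  assumes A: "\<And>m n. \<bar>A m n\<bar> \<le> C * envelope \<alpha> m n" and "C \<ge> 0" and "\<alpha> > real r"
  shows "(\<lambda>js. path_prod A m js n) summable_on {js. length js = r}"
proof -
  \<comment> \<open>The denominator \<open>r + 1\<close>, where \<open>r\<close> would be optimal, covers the case \<open>r = 0\<close>.\<close>
  define \<epsilon> where "\<epsilon> = 2 * (\<alpha> - r) / (r + 1)"
  have "\<epsilon> > 0" using assms by (simp add: \<epsilon>_def)
  have \<epsilon>: "- \<alpha> \<le> \<alpha> - r * (2 + \<epsilon>)"
  proof -
    have "r * \<epsilon> \<le> (r + 1) * \<epsilon>" using \<open>\<epsilon> > 0\<close> by simp
    also have "\<dots> = 2 * (\<alpha> - r)" by (simp add: \<epsilon>_def)
    finally show ?thesis by (simp add: algebra_simps)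
  qed
  have A': "\<bar>A m n\<bar> \<le> C * ((real m + 1) powr (1/2 + \<gamma>) * (real n + 1) powr (1/2 - \<gamma>))"
    if "\<bar>\<gamma>\<bar> \<le> \<alpha>" for m n \<gamma>
    using A[of m n] mult_left_mono[OF envelope_le_powr[OF that] \<open>C \<ge> 0\<close>] by (rule order.trans)
  define f where "f = (\<lambda>j::nat. (real j + 1) powr (- 1 - \<epsilon>))"
  have "summable (\<lambda>j. real j powr (- 1 - \<epsilon>))"
    using \<open>\<epsilon> > 0\<close> by (simp add: summable_real_powr_iff)
  then have "summable f"
    by (subst (asm) summable_Suc_iff[symmetric]) (simp add: f_def add_ac)
  then have "f summable_on UNIV"
    by (subst summable_on_UNIV_nonneg_real_iff) (auto simp: f_def)
  then have "(\<lambda>js. \<Prod>j\<leftarrow>js. f j) summable_on {js. length js = r}"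
    by (rule summable_on_prod_list) (simp add: f_def)
  then have "(\<lambda>js. (C ^ Suc r * (real m + 1) powr (1/2 + \<alpha>) * (real n + 1) powr (1/2 - (\<alpha> - r * (2 + \<epsilon>))))
      * (\<Prod>j\<leftarrow>js. f j)) summable_on {js. length js = r}"
    by (rule summable_on_cmult_right)
  then have "(\<lambda>js. norm (path_prod A m js n)) summable_on {js. length js = r}"
  proof (rule summable_on_comparison_test)
    fix js :: "nat list" assume "js \<in> {js. length js = r}"
    then show "norm (path_prod A m js n) \<le> (C ^ Suc r * (real m + 1) powr (1/2 + \<alpha>)
        * (real n + 1) powr (1/2 - (\<alpha> - r * (2 + \<epsilon>)))) * (\<Prod>j\<leftarrow>js. f j)"
      using path_prod_abs_le[where A = A and \<gamma> = \<alpha> and js = js and m = m and n = n,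
        OF A' \<open>C \<ge> 0\<close> \<open>\<epsilon> > 0\<close>] \<epsilon>
      by (simp add: f_def mult_ac)
  qed simp
  then show ?thesis by (simp only: flip: summable_on_iff_abs_summable_on_real)
qed

section \<open>Divergence of the path sums\<close>

text \<open>
  An injective choice of index tuples with alternating parities, along which no entry of the
  matrix vanishes; \<open>b\<close> says whether the first index is odd. If all parameters lie in
  \<open>{K..<2 * K}\<close>, then all indices are comparable to \<open>K\<close>.
\<close>

fun zigzag :: "bool \<Rightarrow> nat list \<Rightarrow> nat list" where
  "zigzag b [] = []"
| "zigzag b (t # ts) = (2 * t + of_bool b) # zigzag (\<not> b) ts"

lemma length_zigzag [simp]: "length (zigzag b ts) = length ts"
  by (induction b ts rule: zigzag.induct) auto

lemma zigzag_inject [simp]: "zigzag b ts = zigzag b us \<longleftrightarrow> ts = us"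
proof (induction b ts arbitrary: us rule: zigzag.induct)
  case (1 b)
  then show ?case by (cases us) auto
next
  case (2 b t ts)
  then show ?case by (cases us) auto
qed

lemma envelope_ge_block:
  assumes "K \<le> real m + 1" "real m + 1 \<le> 4 * K" "K \<le> real n + 1" "real n + 1 \<le> 4 * K" "K > 0" "\<alpha> \<ge> 0"
  shows "envelope \<alpha> m n \<ge> K * (1/4) powr \<alpha>"
  unfolding envelope_def
proof (intro mult_mono)
  have "K * K \<le> (real m + 1) * (real n + 1)" using assms by (intro mult_mono) auto
  then show "K \<le> sqrt ((real m + 1) * (real n + 1))"
    using assms by (intro real_le_rsqrt) (simp add: power2_eq_square)
  show "(1/4) powr \<alpha> \<le> ((real (min m n) + 1) / (real (max m n) + 1)) powr \<alpha>"
    using assms by (intro powr_mono2) (auto simp: field_simps min_def max_def)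
qed auto

text \<open>
  For the first and last factor of a path, of which one index is fixed and the other is of
  size \<open>K\<close>.
\<close>

lemma envelope_ge_edge:
  assumes "K \<le> (real m + 1) * (real n + 1)" "real m + 1 \<le> 4 * K" "real n + 1 \<le> 4 * K" "K > 0" "\<alpha> \<ge> 0"
  shows "envelope \<alpha> m n \<ge> sqrt K * (1 / (4 * K)) powr \<alpha>"
  unfolding envelope_def
proof (intro mult_mono)
  show "sqrt K \<le> sqrt ((real m + 1) * (real n + 1))" using assms by simp
  have "1 / (4 * K) \<le> (real (min m n) + 1) / (real (max m n) + 1)"
    using assms by (intro frac_le) auto
  then show "(1 / (4 * K)) powr \<alpha> \<le> ((real (min m n) + 1) / (real (max m n) + 1)) powr \<alpha>"
    using assms by (intro powr_mono2) auto
qed auto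

lemma path_prod_zigzag_ge:
  assumes A: "\<And>m n. odd (m + n) \<Longrightarrow> c * envelope \<alpha> m n \<le> \<bar>A m n\<bar>" and "c > 0" and "\<alpha> \<ge> 0"
    and "K > 0" and "set ts \<subseteq> {K..<2 * K}" and "real K \<le> real x + 1" and "real x + 1 \<le> 4 * real K"
    and "b = even x" and "n \<le> 1" and "odd (x + length ts + n)"
  shows "(c * real K * (1/4) powr \<alpha>) ^ length ts * (c * sqrt (real K) * (1 / (4 * real K)) powr \<alpha>)
      \<le> \<bar>path_prod A x (zigzag b ts) n\<bar>"
  using assms(5-)
proof (induction ts arbitrary: x b)
  case Nil
  have "sqrt (real K) * (1 / (4 * real K)) powr \<alpha> \<le> envelope \<alpha> x n"
  proof (rule envelope_ge_edge)
    have "real K * 1 \<le> (real x + 1) * (real n + 1)" using Nil by (intro mult_mono) auto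
    then show "real K \<le> (real x + 1) * (real n + 1)" by simp
    show "real n + 1 \<le> 4 * real K" using Nil \<open>K > 0\<close> by linarith
  qed (use Nil \<open>K > 0\<close> \<open>\<alpha> \<ge> 0\<close> in auto)
  then have "c * (sqrt (real K) * (1 / (4 * real K)) powr \<alpha>) \<le> c * envelope \<alpha> x n"
    using \<open>c > 0\<close> by (intro mult_left_mono) auto
  also have "\<dots> \<le> \<bar>A x n\<bar>" using Nil by (intro A) auto
  finally show ?case by (simp add: mult.assoc)
next
  case (Cons t ts)
  define y where "y = 2 * t + of_bool b"
  have t: "K \<le> t" "t + 1 \<le> 2 * K" using Cons.prems by auto
  have y: "real K \<le> real y + 1" "real y + 1 \<le> 4 * real K"
    using t by (auto simp: y_def of_bool_def)
  have "real K * (1/4) powr \<alpha> \<le> envelope \<alpha> x y"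
    by (rule envelope_ge_block) (use y Cons.prems \<open>K > 0\<close> \<open>\<alpha> \<ge> 0\<close> in auto)
  then have "c * (real K * (1/4) powr \<alpha>) \<le> c * envelope \<alpha> x y"
    using \<open>c > 0\<close> by (intro mult_left_mono) auto
  also have "\<dots> \<le> \<bar>A x y\<bar>" using Cons.prems by (intro A) (auto simp: y_def)
  finally have 1: "c * real K * (1/4) powr \<alpha> \<le> \<bar>A x y\<bar>" by (simp add: mult.assoc)
  have 2: "(c * real K * (1/4) powr \<alpha>) ^ length ts * (c * sqrt (real K) * (1 / (4 * real K)) powr \<alpha>)
      \<le> \<bar>path_prod A y (zigzag (\<not> b) ts) n\<bar>"
    by (rule Cons.IH) (use y Cons.prems in \<open>auto simp: y_def\<close>)
  have "(c * real K * (1/4) powr \<alpha>) * ((c * real K * (1/4) powr \<alpha>) ^ length ts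
         * (c * sqrt (real K) * (1 / (4 * real K)) powr \<alpha>))
      \<le> \<bar>A x y\<bar> * \<bar>path_prod A y (zigzag (\<not> b) ts) n\<bar>"
    using \<open>c > 0\<close> by (intro mult_mono 1 2) auto
  then show ?case by (simp add: y_def abs_mult mult.assoc)
qed

text \<open>
  The \<open>r + 2\<close> factors multiply to at least a constant times \<open>K powr (Suc r - 2 * \<alpha>)\<close>: each of
  the \<open>r\<close> inner factors contributes \<open>K\<close>, each of the two outer ones \<open>sqrt K * K powr (- \<alpha>)\<close>.
  For \<open>\<alpha> \<le> Suc r\<close> this compensates the number \<open>K ^ Suc r\<close> of such paths.
\<close>

lemma path_prod_zigzag_ge_0:
  assumes A: "\<And>m n. odd (m + n) \<Longrightarrow> c * envelope \<alpha> m n \<le> \<bar>A m n\<bar>" and "c > 0" and "\<alpha> \<ge> 0"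
    and "K > 0" and "set ts \<subseteq> {K..<2 * K}" and "length ts = Suc r" and "\<alpha> \<le> real (Suc r)"
    and "n \<le> 1" and "even (r + n)"
  shows "(c * (1/4) powr \<alpha>) ^ Suc (Suc r) / real K ^ Suc r \<le> \<bar>path_prod A 0 (zigzag True ts) n\<bar>"
proof -
  obtain t us where ts: "ts = t # us" using \<open>length ts = Suc r\<close> by (cases ts) auto
  define y where "y = 2 * t + 1"
  define e where "e = c * sqrt (real K) * (1 / (4 * real K)) powr \<alpha>"
  have t: "K \<le> t" "t + 1 \<le> 2 * K" using assms ts by auto
  have y: "real K \<le> real y + 1" "real y + 1 \<le> 4 * real K" using t by (auto simp: y_def)
  have "e \<ge> 0" using \<open>c > 0\<close> by (simp add: e_def)
  have "sqrt (real K) * (1 / (4 * real K)) powr \<alpha> \<le> envelope \<alpha> 0 y"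
    by (rule envelope_ge_edge) (use y \<open>K > 0\<close> \<open>\<alpha> \<ge> 0\<close> in auto)
  then have "c * (sqrt (real K) * (1 / (4 * real K)) powr \<alpha>) \<le> c * envelope \<alpha> 0 y"
    using \<open>c > 0\<close> by (intro mult_left_mono) auto
  also have "\<dots> \<le> \<bar>A 0 y\<bar>" by (intro A) (auto simp: y_def)
  finally have 1: "e \<le> \<bar>A 0 y\<bar>" by (simp add: e_def mult.assoc)
  have 2: "(c * real K * (1/4) powr \<alpha>) ^ r * e \<le> \<bar>path_prod A y (zigzag False us) n\<bar>"
    using path_prod_zigzag_ge[where A = A, OF A \<open>c > 0\<close> \<open>\<alpha> \<ge> 0\<close> \<open>K > 0\<close>, of us y False n] assms ts y
    by (auto simp: y_def e_def)
  have pow: "(1 / real K) ^ (2 * Suc r) \<le> (1 / real K) powr (2 * \<alpha>)"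
  proof -
    have "(1 / real K) ^ (2 * Suc r) = (1 / real K) powr (2 * real (Suc r))"
      using \<open>K > 0\<close> by (subst powr_realpow[symmetric]) auto
    also have "\<dots> \<le> (1 / real K) powr (2 * \<alpha>)"
      using \<open>K > 0\<close> \<open>\<alpha> \<le> real (Suc r)\<close> by (intro powr_mono') auto
    finally show ?thesis .
  qed
  have "(c * (1/4) powr \<alpha>) ^ Suc (Suc r) / real K ^ Suc r
      = (c * (1/4) powr \<alpha>) ^ Suc (Suc r) * real K ^ Suc r * (1 / real K) ^ (2 * Suc r)"
    using \<open>K > 0\<close> by (simp add: power_mult power2_eq_square field_simps flip: power_mult_distrib)
  also have "\<dots> \<le> (c * (1/4) powr \<alpha>) ^ Suc (Suc r) * real K ^ Suc r * (1 / real K) powr (2 * \<alpha>)"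
    using \<open>c > 0\<close> by (intro mult_left_mono pow) auto
  also have "\<dots> = e * ((c * real K * (1/4) powr \<alpha>) ^ r * e)"
  proof -
    have "(1 / (4 * real K)) powr \<alpha> = (1/4) powr \<alpha> * (1 / real K) powr \<alpha>"
      by (simp flip: powr_mult)
    moreover have "(1 / real K) powr (2 * \<alpha>) = (1 / real K) powr \<alpha> * (1 / real K) powr \<alpha>"
      by (simp flip: powr_add)
    moreover have "real K = sqrt (real K) * sqrt (real K)" by simp
    ultimately show ?thesis
      by (simp add: e_def power_mult_distrib)
  qed
  also have "\<dots> \<le> \<bar>A 0 y\<bar> * \<bar>path_prod A y (zigzag False us) n\<bar>"
    using \<open>e \<ge> 0\<close> \<open>c > 0\<close> by (intro mult_mono 1 2) auto
  finally show ?thesis by (simp add: ts y_def abs_mult)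
qed

text \<open>
  A block \<open>{K..<2 * K}\<close> supplies \<open>K ^ r\<close> tuples, whose terms sum to at least \<open>d\<close>. Such a
  block exists outside any finite set of tuples, so the Cauchy criterion fails.
\<close>

lemma not_summable_on_dyadic_blocks:
  fixes f :: "nat list \<Rightarrow> real"
  assumes "d > 0" and "r > 0"
    and f: "\<And>K ts. K > 0 \<Longrightarrow> length ts = r \<Longrightarrow> set ts \<subseteq> {K..<2 * K} \<Longrightarrow> d / real K ^ r \<le> f ts"
  shows "\<not> f summable_on {ts. length ts = r}"
proof
  assume "f summable_on {ts. length ts = r}"
  then have "(f has_sum infsum f {ts. length ts = r}) {ts. length ts = r}" by (rule has_sum_infsum)
  then have "eventually (\<lambda>F. dist (sum f F) (infsum f {ts. length ts = r}) < d / 2)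
      (finite_subsets_at_top {ts. length ts = r})"
    using \<open>d > 0\<close> unfolding has_sum_def by (intro tendstoD) auto
  then obtain F where F: "finite F" "F \<subseteq> {ts. length ts = r}"
    and close: "\<And>G. finite G \<Longrightarrow> F \<subseteq> G \<Longrightarrow> G \<subseteq> {ts. length ts = r} \<Longrightarrow>
        dist (sum f G) (infsum f {ts. length ts = r}) < d / 2"
    by (auto simp: eventually_finite_subsets_at_top)
  have "finite (\<Union> (set ` F))" using F by auto
  then obtain k where k: "\<Union> (set ` F) \<subseteq> {..<k}" using finite_nat_bounded by blast
  define K where "K = Suc k"
  define B where "B = {ts. set ts \<subseteq> {K..<2 * K} \<and> length ts = r}"
  have B: "finite B" "card B = K ^ r"
    unfolding B_def using finite_lists_length_eq[of "{K..<2*K}" r] card_lists_length_eq[of "{K..<2*K}" r]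
    by auto
  have "F \<inter> B = {}"
  proof (rule ccontr)
    assume "F \<inter> B \<noteq> {}"
    then obtain ts where ts: "ts \<in> F" "ts \<in> B" by blast
    then obtain t where "t \<in> set ts" using \<open>r > 0\<close> by (cases ts) (auto simp: B_def)
    with ts k show False by (force simp: B_def K_def)
  qed
  then have "sum f (F \<union> B) = sum f F + sum f B" using F B by (intro sum.union_disjoint)
  moreover have "d \<le> sum f B"
  proof -
    have "d = (\<Sum>ts\<in>B. d / real K ^ r)" using B by (simp add: K_def)
    also have "\<dots> \<le> sum f B" by (intro sum_mono f) (auto simp: B_def K_def)
    finally show ?thesis .
  qed
  moreover have "dist (sum f (F \<union> B)) (infsum f {ts. length ts = r}) < d / 2"
    "dist (sum f F) (infsum f {ts. length ts = r}) < d / 2"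
    using close[of "F \<union> B"] close[of F] F B(1) by (auto simp: B_def)
  ultimately show False unfolding dist_real_def by linarith
qed

text \<open>
  The entry is chosen such that the parities alternate along the whole path: the indices
  start at \<open>0\<close> and end, after \<open>r + 1\<close> changes of parity, at \<open>(r + 1) mod 2\<close>.
\<close>

lemma not_summable_path_prod:
  assumes A: "\<And>m n. odd (m + n) \<Longrightarrow> c * envelope \<alpha> m n \<le> \<bar>A m n\<bar>" and "c > 0" and "\<alpha> \<ge> 0"
    and "r > 0" and "\<alpha> \<le> real r"
  shows "\<not> (\<lambda>js. path_prod A 0 js ((r + 1) mod 2)) summable_on {js. length js = r}"
proof
  let ?f = "\<lambda>js. path_prod A 0 js ((r + 1) mod 2)"
  let ?L = "{ts :: nat list. length ts = r}"
  assume "?f summable_on ?L"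
  then have "(\<lambda>js. norm (?f js)) summable_on ?L"
    by (simp only: flip: summable_on_iff_abs_summable_on_real)
  then have "(\<lambda>js. norm (?f js)) summable_on zigzag True ` ?L"
    by (rule summable_on_subset_banach) auto
  then have "(\<lambda>ts. \<bar>?f (zigzag True ts)\<bar>) summable_on ?L"
    by (subst (asm) summable_on_reindex) (auto simp: inj_on_def o_def)
  moreover have "\<not> (\<lambda>ts. \<bar>?f (zigzag True ts)\<bar>) summable_on ?L"
  proof (rule not_summable_on_dyadic_blocks)
    show "(c * (1/4) powr \<alpha>) ^ Suc r > 0" using \<open>c > 0\<close> by simp
    obtain q where q: "r = Suc q" using \<open>r > 0\<close> by (cases r) auto
    fix K :: nat and ts :: "nat list"
    assume "K > 0" "length ts = r" "set ts \<subseteq> {K..<2 * K}"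
    then show "(c * (1/4) powr \<alpha>) ^ Suc r / real K ^ r \<le> \<bar>?f (zigzag True ts)\<bar>"
      unfolding q using assms
      by (intro path_prod_zigzag_ge_0) (auto simp: q mod_2_eq_odd)
  qed (use \<open>r > 0\<close> in auto)
  ultimately show False by contradiction
qed

section \<open>The index of the ultraspherical weight\<close>

theorem theorem8:
  fixes \<alpha> :: real and s :: nat and p :: "nat \<Rightarrow> real poly"
  assumes "\<alpha> > 0" and "s \<ge> 1"
    and "orthonormal_polys (ultraspherical_weight \<alpha>) p"
  shows "ind_ge (ultraspherical_weight \<alpha>) p s \<longleftrightarrow> \<alpha> > real s - 1"
proof -
  let ?D = "diff_matrix (ultraspherical_weight \<alpha>) p"
  interpret gegenbauer_functional "weighted_integral \<alpha>" \<alpha> p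
    using assms by (intro gegenbauer_functional_weighted_integral)
  obtain c C where "c > 0" and "C \<ge> 0"
    and upper: "\<And>m n. \<bar>?D m n\<bar> \<le> C * envelope \<alpha> m n"
    and lower: "\<And>m n. odd (m + n) \<Longrightarrow> c * envelope \<alpha> m n \<le> \<bar>?D m n\<bar>"
    unfolding diff_matrix_eq_weighted_integral[OF assms(1)] using skew_entries_bounds by blast
  show ?thesis
  proof
    assume ind: "ind_ge (ultraspherical_weight \<alpha>) p s"
    show "\<alpha> > real s - 1"
    proof (cases "s = 1")
      case False
      show ?thesis
      proof (rule ccontr)
        assume "\<not> \<alpha> > real s - 1"
        then have "\<alpha> \<le> real (s - 1)" using assms(2) by simp
        then have "\<not> (\<lambda>js. path_prod ?D 0 js ((s - 1 + 1) mod 2)) summable_on {js. length js = s - 1}"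
          using assms False by (intro not_summable_path_prod[where A = ?D, OF lower \<open>c > 0\<close>]) auto
        moreover have "diff_power_bounded (ultraspherical_weight \<alpha>) p s"
          using ind assms(2) by (simp add: ind_ge_def)
        ultimately show False unfolding diff_power_bounded_def by blast
      qed
    qed (use assms(1) in simp)
  next
    assume "\<alpha> > real s - 1"
    have "diff_power_bounded (ultraspherical_weight \<alpha>) p k" if "k \<in> {1..s}" for k
    proof -
      have "\<alpha> > real (k - 1)" using that \<open>\<alpha> > real s - 1\<close> by auto
      then show ?thesis
        unfolding diff_power_bounded_def
        using summable_path_prod[where A = ?D, OF upper \<open>C \<ge> 0\<close>]
          diff_matrix_finite_ultraspherical[OF assms(1)] by blast
    qed
    then show "ind_ge (ultraspherical_weight \<alpha>) p s" by (simp add: ind_ge_def)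
  qed
qed

end
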